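(* Let $\mathcal{G}=(V,E,w)$ be an undirected weighted graph with $n$ nodes and Laplacian matrix $L$, and let $C(S)=\rho(\mathcal{G}-S)-\rho(\mathcal{G})$ for $S\subseteq E$. Then the submodularity ratio $\gamma$ of the set function $C$ is bounded by $$1>\gamma\ge\left(\frac{1}{1+\lambda_{n-1}(L)}\right)^2,$$ and its curvature $\alpha$ is bounded by $$0<\alpha\le 1-\left(\frac{1}{1+\lambda_{n-1}(L)}\right)^2,$$ where $\lambda_{n-1}(L)$ is the largest eigenvalue of $L$.
   Context: $\mathcal{G}=(V,E,w)$ is a finite undirected graph with $|V|=n$ and positive edge weights $w:E\to\mathbb{R}_+$. Its Laplacian is $L=D-A$, where $A$ is the weighted adjacency matrix and $D$ the diagonal (weighted) degree matrix; its eigenvalues are $0=\lambda_0\le\lambda_1\le\cdots\le\lambda_{n-1}$. The forest matrix is $\Omega=(I+L)^{-1}=(\omega_{ij})_{n\times n}$, and the forest index is $\rho(\mathcal{G})=\sum_{i<j}(\omega_{ii}+\omega_{jj}-2\omega_{ij})=n\,\mathrm{Tr}(\Omega)-n$. For $S\subseteq E$, $\mathcal{G}-S$ is the weighted graph on the same node set $V$ obtained by deleting the edges in $S$ (weights of the remaining edges unchanged). For a non-negative set function $f:2^X\to\mathbb{R}$ on a finite set $X$ and $S,T\subseteq X$, write $\Theta_S(T)=f(S\cup T)-f(T)$ (and $\Theta_i=\Theta_{\{i\}}$). The submodularity ratio of $f$ is the largest $\gamma\in\mathbb{R}_+$ such that $\sum_{i\in S\setminus T}\Theta_i(T)\ge\gamma\,\Theta_S(T)$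 for all $S,T\subseteq X$. The curvature of $f$ is the smallest $\alpha\in\mathbb{R}_+$ such that $\Theta_j((T\setminus\{j\})\cup S)\ge(1-\alpha)\,\Theta_j(T\setminus\{j\})$ for all $S,T\subseteq X$ and all $j\in T\setminus S$. Here $X=E$ and $f=C$.
   Formalization: The strict bounds fail in general (single edge: γ=1; unweighted triangle: α=0). Proved: γ≤1, with γ<1 if two edges share an endpoint; α≥0, with α>0 if C is not supermodular. The γ part assumes E nonempty, since otherwise no largest γ exists. *)

theory Defs
  imports "HOL-Analysis.Analysis"
begin

text \<open>
  A weighted graph on the node set \<open>UNIV :: 'n set\<close> is given by its edge set \<open>E\<close>, whose members are
  two-element sets of nodes, and a weight function \<open>w\<close> that matters only on \<open>E\<close>.
  The number of nodes is \<open>CARD('n)\<close>. Deleting the edges in \<open>S\<close> yields the pair \<open>E - S\<close>, \<open>w\<close>.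
\<close>

definition weighted_graph :: "'n::finite set set \<Rightarrow> ('n set \<Rightarrow> real) \<Rightarrow> bool" where
  "weighted_graph E w \<longleftrightarrow> (\<forall>e\<in>E. card e = 2 \<and> 0 < w e)"

definition adjacency_matrix :: "'n::finite set set \<Rightarrow> ('n set \<Rightarrow> real) \<Rightarrow> real^'n^'n" where
  "adjacency_matrix E w = (\<chi> i j. if {i, j} \<in> E then w {i, j} else 0)"

definition degree_matrix :: "'n::finite set set \<Rightarrow> ('n set \<Rightarrow> real) \<Rightarrow> real^'n^'n" where
  "degree_matrix E w = (\<chi> i j. if i = j then (\<Sum>e\<in>{e \<in> E. i \<in> e}. w e) else 0)"

definition laplacian :: "'n::finite set set \<Rightarrow> ('n set \<Rightarrow> real) \<Rightarrow> real^'n^'n" where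
  "laplacian E w = degree_matrix E w - adjacency_matrix E w"

definition largest_eigenvalue :: "real^'n^'n \<Rightarrow> real" where
  "largest_eigenvalue A = Max {k. \<exists>v. v \<noteq> 0 \<and> A *v v = k *\<^sub>R v}"

definition forest_matrix :: "'n::finite set set \<Rightarrow> ('n set \<Rightarrow> real) \<Rightarrow> real^'n^'n" where
  "forest_matrix E w = matrix_inv (mat 1 + laplacian E w)"

text \<open>
  The index type carries no order, so the sum over pairs \<open>i < j\<close> is written as half the sum over all
  ordered pairs: the summand is symmetric in \<open>i\<close> and \<open>j\<close> and vanishes for \<open>i = j\<close>.
\<close>

definition forest_index :: "'n::finite set set \<Rightarrow> ('n set \<Rightarrow> real) \<Rightarrow> real" where
  "forest_index E w =
    (let \<Omega> = forest_matrix E w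
     in (\<Sum>i\<in>UNIV. \<Sum>j\<in>UNIV. \<Omega> $ i $ i + \<Omega> $ j $ j - 2 * \<Omega> $ i $ j) / 2)"

definition edge_removal_gain ::
    "'n::finite set set \<Rightarrow> ('n set \<Rightarrow> real) \<Rightarrow> 'n set set \<Rightarrow> real" where
  "edge_removal_gain E w S = forest_index (E - S) w - forest_index E w"

definition marginal :: "('a set \<Rightarrow> real) \<Rightarrow> 'a set \<Rightarrow> 'a set \<Rightarrow> real" where
  "marginal f S T = f (S \<union> T) - f T"

text \<open>
  A largest \<open>\<gamma>\<close> or a smallest \<open>\<alpha>\<close> need not exist for every \<open>f\<close> (for \<open>X = {}\<close> every \<open>\<gamma> \<ge> 0\<close> is
  admissible), hence relations rather than functions. Both determine their last argument uniquely.
\<close>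

definition is_submodularity_ratio :: "'a set \<Rightarrow> ('a set \<Rightarrow> real) \<Rightarrow> real \<Rightarrow> bool" where
  "is_submodularity_ratio X f \<gamma> \<longleftrightarrow>
    (let admissible = {g. 0 \<le> g \<and>
        (\<forall>S T. S \<subseteq> X \<longrightarrow> T \<subseteq> X \<longrightarrow> (\<Sum>i\<in>S - T. marginal f {i} T) \<ge> g * marginal f S T)}
     in \<gamma> \<in> admissible \<and> (\<forall>g\<in>admissible. g \<le> \<gamma>))"

definition is_curvature :: "'a set \<Rightarrow> ('a set \<Rightarrow> real) \<Rightarrow> real \<Rightarrow> bool" where
  "is_curvature X f \<alpha> \<longleftrightarrow>
    (let admissible = {a. 0 \<le> a \<and>
        (\<forall>S T j. S \<subseteq> X \<longrightarrow> T \<subseteq> X \<longrightarrow> j \<in> T - S \<longrightarrow>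
          marginal f {j} ((T - {j}) \<union> S) \<ge> (1 - a) * marginal f {j} (T - {j}))}
     in \<alpha> \<in> admissible \<and> (\<forall>a\<in>admissible. \<alpha> \<le> a))"

definition supermodular :: "'a set \<Rightarrow> ('a set \<Rightarrow> real) \<Rightarrow> bool" where
  "supermodular X f \<longleftrightarrow>
    (\<forall>A B. A \<subseteq> X \<longrightarrow> B \<subseteq> X \<longrightarrow> f A + f B \<le> f (A \<union> B) + f (A \<inter> B))"

end

theory Submission
  imports Defs
begin

text \<open>
  Let \<open>e\<close> be an edge of \<open>F\<close> with incidence vector \<open>b\<close>, and let \<open>x\<close>, \<open>y\<close> be the solutions of
  \<open>(I + L\<^sub>F) x = b\<close> and \<open>(I + L\<^bsub>F - e\<^esub>) y = b\<close>. Since \<open>L\<^sub>F = L\<^bsub>F - e\<^esub> + w\<^sub>e b b\<^sup>T\<close>, removing \<open>e\<close>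
  raises the forest index by \<open>n w\<^sub>e (x \<bullet> y)\<close>, and \<open>y\<close> is the multiple of \<open>x\<close> by
  \<open>1 + w\<^sub>e (b \<bullet> y) \<ge> 1\<close>. Hence \<open>x \<bullet> x \<le> x \<bullet> y \<le> y \<bullet> y\<close>, and as the spectra of both matrices lie in
  \<open>[1, 1 + \<lambda>]\<close>, every marginal gain of \<open>e\<close> lies between \<open>2 n w\<^sub>e / (1 + \<lambda>)\<^sup>2\<close> and \<open>2 n w\<^sub>e\<close>.
  Both bounds follow from this by telescoping. For \<open>\<gamma> < 1\<close>, delete all edges but two adjacent
  ones: on a path with two edges the gain of an edge strictly grows when the other one is removed.
\<close>

section \<open>Set functions with marginals in a fixed ratio\<close>

lemma marginal_insert: "marginal f {j} T = f (insert j T) - f T"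
  by (simp add: marginal_def)

text \<open>Start from \<open>A \<inter> B\<close> and add the elements of \<open>A - B\<close> one
  at a time: each gains at least as much when added on top of \<open>B\<close>, and the inequalities
  telescope.\<close>

lemma supermodular_if_marginals_increase:
  assumes fin: "finite X"
    and incr: "\<And>S T j. S \<subseteq> X \<Longrightarrow> T \<subseteq> X \<Longrightarrow> j \<in> T - S \<Longrightarrow>
      marginal f {j} (T - {j}) \<le> marginal f {j} ((T - {j}) \<union> S)"
  shows "supermodular X f"
  unfolding supermodular_def
proof (intro allI impI)
  fix A B assume AB: "A \<subseteq> X" "B \<subseteq> X"
  have step: "f (D \<union> (A \<inter> B)) - f (A \<inter> B) \<le> f (D \<union> B) - f B"
    if "finite D" "D \<subseteq> A - B" for D
    using that
  proof (induction D rule: finite_induct)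
    case empty
    then show ?case by simp
  next
    case (insert j D)
    let ?T = "insert j (D \<union> (A \<inter> B))" and ?S = "D \<union> B"
    have T: "?T - {j} = D \<union> (A \<inter> B)" "(D \<union> (A \<inter> B)) \<union> ?S = D \<union> B"
      using insert.hyps insert.prems by auto
    have "marginal f {j} (?T - {j}) \<le> marginal f {j} ((?T - {j}) \<union> ?S)"
      by (rule incr) (use insert.hyps insert.prems AB in auto)
    then have "f (insert j (D \<union> (A \<inter> B))) - f (D \<union> (A \<inter> B)) \<le> f (insert j (D \<union> B)) - f (D \<union> B)"
      unfolding T marginal_insert .
    with insert show ?case by simp
  qed
  have "finite (A - B)"
    using AB fin by (meson finite_Diff finite_subset)
  from step[OF this] have "f ((A - B) \<union> (A \<inter> B)) - f (A \<inter> B) \<le> f ((A - B) \<union> B) - f B"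
    by simp
  moreover have "(A - B) \<union> (A \<inter> B) = A" "(A - B) \<union> B = A \<union> B" by auto
  ultimately show "f A + f B \<le> f (A \<union> B) + f (A \<inter> B)" by simp
qed

text \<open>The bound \<open>c j\<close> does not depend on \<open>T\<close>, so the marginals of
  \<open>j\<close> at any two sets are comparable through it. For the forest index,
  \<open>c e\<close> is \<open>2 * CARD('n) * w e\<close> and \<open>\<kappa>\<close> is the square
  of 1 over 1 plus the largest eigenvalue.\<close>

context
  fixes X :: "'a set" and f :: "'a set \<Rightarrow> real" and c :: "'a \<Rightarrow> real" and \<kappa> :: real
  assumes fin: "finite X"
    and \<kappa>_pos: "0 < \<kappa>"
    and c_pos: "\<And>j. j \<in> X \<Longrightarrow> 0 < c j"
    and lower: "\<And>T j. T \<subseteq> X \<Longrightarrow> j \<in> X - T \<Longrightarrow> \<kappa> * c j \<le> marginal f {j} T"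
    and upper: "\<And>T j. T \<subseteq> X \<Longrightarrow> j \<in> X - T \<Longrightarrow> marginal f {j} T \<le> c j"
begin

text \<open>Telescoping over the elements of \<open>S - T\<close>; each step is positive because
  \<open>\<kappa> * c j\<close> is.\<close>

lemma marginal_bounds:
  assumes T: "T \<subseteq> X" and S: "S \<subseteq> X"
  shows "0 \<le> marginal f S T \<and> marginal f S T \<le> (\<Sum>j\<in>S - T. c j)"
proof -
  have "0 \<le> f (D \<union> T) - f T \<and> f (D \<union> T) - f T \<le> (\<Sum>j\<in>D. c j)"
    if "finite D" "D \<subseteq> S - T" for D
    using that
  proof (induction D rule: finite_induct)
    case empty
    then show ?case by simp
  next
    case (insert j D)
    have j: "D \<union> T \<subseteq> X" "j \<in> X - (D \<union> T)" using insert S T by auto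
    have "0 < \<kappa> * c j" using \<kappa>_pos c_pos j by simp
    with lower[OF j] upper[OF j] insert show ?case
      by (simp add: marginal_insert)
  qed
  moreover have "finite (S - T)" "(S - T) \<union> T = S \<union> T"
    using S fin by (auto intro: finite_subset)
  ultimately show ?thesis
    unfolding marginal_def by (metis order_refl)
qed

text \<open>The admissible values form a closed set, bounded above and containing
  \<open>\<kappa>\<close>, so the supremum is attained. Since it is itself admissible, a single pair
  violating the inequality for the value 1 already forces it below 1.\<close>

lemma submodularity_ratio_exists:
  assumes ne: "X \<noteq> {}"
  shows "\<exists>\<gamma>. is_submodularity_ratio X f \<gamma> \<and> \<kappa> \<le> \<gamma> \<and> \<gamma> \<le> 1 \<and>
    (\<forall>S T. S \<subseteq> X \<longrightarrow> T \<subseteq> X \<longrightarrow> (\<Sum>i\<in>S - T. marginal f {i} T) < marginal f S T \<longrightarrow> \<gamma> < 1)"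
proof -
  define A where "A = {g. 0 \<le> g \<and>
    (\<forall>S T. S \<subseteq> X \<longrightarrow> T \<subseteq> X \<longrightarrow> (\<Sum>i\<in>S - T. marginal f {i} T) \<ge> g * marginal f S T)}"
  have "closed A"
    unfolding A_def
    by (intro closed_Collect_conj closed_Collect_all closed_Collect_imp open_Collect_const
        closed_Collect_le continuous_intros)
  have \<kappa>: "\<kappa> \<in> A"
  proof -
    have "\<kappa> * marginal f S T \<le> (\<Sum>i\<in>S - T. marginal f {i} T)" if "S \<subseteq> X" "T \<subseteq> X" for S T
    proof -
      have "\<kappa> * marginal f S T \<le> \<kappa> * (\<Sum>j\<in>S - T. c j)"
        using marginal_bounds that \<kappa>_pos by simp
      also have "\<dots> \<le> (\<Sum>i\<in>S - T. marginal f {i} T)"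
        unfolding sum_distrib_left by (rule sum_mono) (use lower that in auto)
      finally show ?thesis .
    qed
    then show ?thesis using \<kappa>_pos by (auto simp: A_def)
  qed
  obtain e where e: "e \<in> X" using ne by auto
  have le1: "g \<le> 1" if "g \<in> A" for g
  proof -
    \<comment> \<open>For a singleton \<open>S\<close> and empty \<open>T\<close> both sides carry
      the same positive marginal, which caps \<open>g\<close> at 1.\<close>
    have "g * marginal f {e} {} \<le> (\<Sum>i\<in>{e} - {}. marginal f {i} {})"
      using that e unfolding A_def by blast
    moreover have "0 < \<kappa> * c e" using \<kappa>_pos c_pos e by simp
    then have "0 < marginal f {e} {}"
      using lower[of "{}" e] e by simp
    ultimately show ?thesis by simp
  qed
  then have bdd: "bdd_above A" by (auto simp: bdd_above_def)
  have Sup: "Sup A \<in> A"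
    using \<open>closed A\<close> bdd \<kappa> by (intro closed_contains_Sup) auto
  have "is_submodularity_ratio X f (Sup A)"
    unfolding is_submodularity_ratio_def Let_def A_def[symmetric]
    using Sup bdd by (auto intro: cSup_upper)
  moreover have "\<kappa> \<le> Sup A" using \<kappa> bdd by (rule cSup_upper)
  moreover have "Sup A < 1"
    if "S \<subseteq> X" "T \<subseteq> X" and less: "(\<Sum>i\<in>S - T. marginal f {i} T) < marginal f S T" for S T
  proof (rule ccontr)
    assume "\<not> Sup A < 1"
    then have "marginal f S T \<le> Sup A * marginal f S T"
      using marginal_bounds[OF that(2,1)] by (simp add: mult_le_cancel_right1)
    also have "\<dots> \<le> (\<Sum>i\<in>S - T. marginal f {i} T)"
      using Sup that unfolding A_def by blast
    finally show False using less by simp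
  qed
  ultimately show ?thesis using le1[OF Sup] by blast
qed

text \<open>Again an extremum of a closed set is attained. The value \<open>1 - \<kappa>\<close> is
  admissible because one marginal of \<open>j\<close> is at most \<open>c j\<close> and the other at
  least \<open>\<kappa> * c j\<close>; admissibility of 0 says that marginals increase.\<close>

lemma curvature_exists:
  assumes \<kappa>_le: "\<kappa> \<le> 1"
  shows "\<exists>\<alpha>. is_curvature X f \<alpha> \<and> 0 \<le> \<alpha> \<and> \<alpha> \<le> 1 - \<kappa> \<and> (\<not> supermodular X f \<longrightarrow> 0 < \<alpha>)"
proof -
  define A where "A = {a. 0 \<le> a \<and>
    (\<forall>S T j. S \<subseteq> X \<longrightarrow> T \<subseteq> X \<longrightarrow> j \<in> T - S \<longrightarrow>
      marginal f {j} ((T - {j}) \<union> S) \<ge> (1 - a) * marginal f {j} (T - {j}))}"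
  have "closed A"
    unfolding A_def
    by (intro closed_Collect_conj closed_Collect_all closed_Collect_imp open_Collect_const
        closed_Collect_le continuous_intros)
  have \<kappa>: "1 - \<kappa> \<in> A"
  proof -
    have "\<kappa> * marginal f {j} (T - {j}) \<le> marginal f {j} ((T - {j}) \<union> S)"
      if "S \<subseteq> X" "T \<subseteq> X" "j \<in> T - S" for S T j
    proof -
      have "\<kappa> * marginal f {j} (T - {j}) \<le> \<kappa> * c j"
        using upper[of "T - {j}" j] that \<kappa>_pos by auto
      also have "\<dots> \<le> marginal f {j} ((T - {j}) \<union> S)"
        by (rule lower) (use that in auto)
      finally show ?thesis .
    qed
    then show ?thesis using \<kappa>_le by (simp add: A_def)
  qed
  have ge0: "0 \<le> a" if "a \<in> A" for a using that by (simp add: A_def)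
  then have bdd: "bdd_below A" by (auto simp: bdd_below_def)
  have Inf: "Inf A \<in> A"
    using \<open>closed A\<close> bdd \<kappa> by (intro closed_contains_Inf) auto
  have "is_curvature X f (Inf A)"
    unfolding is_curvature_def Let_def A_def[symmetric]
    using Inf bdd by (auto intro: cInf_lower)
  moreover have "Inf A \<le> 1 - \<kappa>" using \<kappa> bdd by (rule cInf_lower)
  moreover have "0 < Inf A" if "\<not> supermodular X f"
  proof (rule ccontr)
    assume "\<not> 0 < Inf A"
    with ge0[OF Inf] have "Inf A = 0" by simp
    with Inf have "0 \<in> A" by simp
    then have "supermodular X f"
      by (intro supermodular_if_marginals_increase fin) (simp add: A_def)
    with that show False by simp
  qed
  ultimately show ?thesis using ge0[OF Inf] by blast
qed

end

section \<open>Symmetric matrices and their largest eigenvalue\<close>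

lemma symmetric_inner_swap:
  fixes A :: "real^'n^'n"
  assumes "transpose A = A"
  shows "x \<bullet> (A *v y) = (A *v x) \<bullet> y"
  using dot_lmul_matrix[of x A y] transpose_matrix_vector[of A x] assms by simp

text \<open>The usual discriminant argument on the form at
  \<open>s *\<^sub>R x - t *\<^sub>R y\<close>. The form may be degenerate, so \<open>c = 0\<close>
  is treated apart.\<close>

lemma psd_Cauchy_Schwarz:
  fixes A :: "real^'n^'n"
  assumes sym: "transpose A = A" and psd: "\<And>v. 0 \<le> v \<bullet> (A *v v)"
  shows "(x \<bullet> (A *v y))\<^sup>2 \<le> (x \<bullet> (A *v x)) * (y \<bullet> (A *v y))"
proof -
  define a h c where "a = x \<bullet> (A *v x)" and "h = x \<bullet> (A *v y)" and "c = y \<bullet> (A *v y)"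
  have h': "y \<bullet> (A *v x) = h"
    using symmetric_inner_swap[OF sym, of y x] by (simp add: h_def inner_commute)
  have quad: "0 \<le> s\<^sup>2 * a - 2 * s * t * h + t\<^sup>2 * c" for s t
    using psd[of "s *\<^sub>R x - t *\<^sub>R y"] h' unfolding a_def c_def h_def
    by (simp add: matrix_vector_mult_diff_distrib matrix_vector_mult_scaleR inner_diff_left
        inner_diff_right algebra_simps power2_eq_square)
  have "c \<ge> 0" using psd c_def by simp
  show ?thesis
  proof (cases "c = 0")
    case True
    have "h = 0"
    proof (rule ccontr)
      assume "h \<noteq> 0"
      \<comment> \<open>With \<open>c = 0\<close> the form is linear in \<open>t\<close>; this
        \<open>t\<close> gives it the value -1.\<close>
      with quad[of 1 "(a + 1) / (2 * h)"] True show False by simp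
    qed
    then show ?thesis using True by (simp add: h_def c_def)
  next
    case False
    have "0 \<le> c * (a * c - h\<^sup>2)"
      using quad[of c h] by (simp add: power2_eq_square algebra_simps)
    then have "h\<^sup>2 \<le> a * c"
      using False \<open>c \<ge> 0\<close> by (simp add: zero_le_mult_iff)
    then show ?thesis by (simp add: a_def h_def c_def)
  qed
qed

text \<open>Cauchy-Schwarz for the form of \<open>A\<close>, applied to \<open>A *v x\<close> and
  \<open>x\<close>, bounds the fourth power of the norm of \<open>A *v x\<close>; this replaces
  diagonalisation.\<close>

lemma psd_norm_le:
  fixes A :: "real^'n^'n"
  assumes sym: "transpose A = A" and psd: "\<And>v. 0 \<le> v \<bullet> (A *v v)"
    and le: "\<And>v. v \<bullet> (A *v v) \<le> \<mu> * (v \<bullet> v)" and "0 \<le> \<mu>"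
  shows "norm (A *v x) \<le> \<mu> * norm x"
proof (cases "A *v x = 0")
  case True
  then show ?thesis using \<open>0 \<le> \<mu>\<close> by simp
next
  case False
  let ?y = "A *v x"
  have "(norm ?y)^2 * (norm ?y)^2 = (?y \<bullet> (A *v x))\<^sup>2"
    by (simp add: power2_norm_eq_inner) (simp add: power2_eq_square)
  also have "\<dots> \<le> (?y \<bullet> (A *v ?y)) * (x \<bullet> (A *v x))"
    by (rule psd_Cauchy_Schwarz[OF sym psd])
  also have "\<dots> \<le> (\<mu> * (?y \<bullet> ?y)) * (\<mu> * (x \<bullet> x))"
    by (rule mult_mono) (use le psd \<open>0 \<le> \<mu>\<close> in auto)
  also have "\<dots> = (norm ?y)^2 * (\<mu> * norm x)^2"
    by (simp add: power2_norm_eq_inner[symmetric] power_mult_distrib power2_eq_square)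
  finally have "(norm ?y)^2 * (norm ?y)^2 \<le> (norm ?y)^2 * (\<mu> * norm x)^2" .
  moreover have "0 < (norm ?y)^2" using False by simp
  ultimately have "(norm ?y)^2 \<le> (\<mu> * norm x)^2" by (rule mult_left_le_imp_le)
  then show ?thesis
    by (rule power2_le_imp_le) (simp add: \<open>0 \<le> \<mu>\<close>)
qed

text \<open>Makes the \<open>Max\<close> in \<open>largest_eigenvalue\<close> meaningful. One
  eigenvector is chosen per eigenvalue; these are nonzero and pairwise orthogonal, hence finitely
  many and distinct.\<close>

lemma finite_eigenvalues_symmetric:
  fixes A :: "real^'n^'n"
  assumes sym: "transpose A = A"
  shows "finite {k. \<exists>v. v \<noteq> 0 \<and> A *v v = k *\<^sub>R v}" (is "finite ?K")
proof -
  obtain v where v: "\<And>k. k \<in> ?K \<Longrightarrow> v k \<noteq> 0 \<and> A *v v k = k *\<^sub>R v k"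
    using bchoice[of ?K "\<lambda>k v. v \<noteq> 0 \<and> A *v v = k *\<^sub>R v"] by auto
  have orth: "v k \<bullet> v l = 0" if "k \<in> ?K" "l \<in> ?K" "k \<noteq> l" for k l
    using symmetric_inner_swap[OF sym, of "v k" "v l"] v[OF that(1)] v[OF that(2)] that(3) by simp
  have "pairwise orthogonal (v ` ?K)"
    using orth by (auto simp: pairwise_def orthogonal_def)
  moreover have "0 \<notin> v ` ?K" using v by force
  ultimately have "finite (v ` ?K)"
    using pairwise_orthogonal_imp_finite by blast
  moreover have "inj_on v ?K"
  proof (rule inj_onI, rule ccontr)
    fix k l assume kl: "k \<in> ?K" "l \<in> ?K" "v k = v l" "k \<noteq> l"
    then have "v k \<bullet> v k = 0" using orth[of k l] by simp
    then show False using v[OF kl(1)] by simp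
  qed
  ultimately show ?thesis by (rule finite_imageD)
qed

text \<open>The Rayleigh quotient attains its maximum \<open>\<mu>\<close> at some \<open>u\<close>; then \<open>\<mu> I - A\<close> is positive
  semidefinite with \<open>u\<close> in the kernel of its quadratic form, so \<open>u\<close> is an eigenvector.\<close>

lemma Rayleigh_le_largest_eigenvalue:
  fixes A :: "real^'n^'n"
  assumes sym: "transpose A = A"
  shows "v \<bullet> (A *v v) \<le> largest_eigenvalue A * (v \<bullet> v)"
proof -
  let ?q = "\<lambda>v. v \<bullet> (A *v v)"
  have "continuous_on (sphere 0 1) ?q"
    by (intro continuous_intros linear_continuous_on matrix_vector_mul_bounded_linear)
  moreover have "axis undefined 1 \<in> sphere (0::real^'n) 1" by simp
  then have "sphere (0::real^'n) 1 \<noteq> {}" by blast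
  ultimately obtain u where u: "norm u = 1" and max: "\<And>v. norm v = 1 \<Longrightarrow> ?q v \<le> ?q u"
    using continuous_attains_sup[of "sphere (0::real^'n) 1" ?q] by auto
  define \<mu> where "\<mu> = ?q u"
  have le: "?q v \<le> \<mu> * (v \<bullet> v)" for v
  proof (cases "v = 0")
    case False
    have "?q v = ?q (v /\<^sub>R norm v) * (v \<bullet> v)"
      using False
      by (simp add: matrix_vector_mult_scaleR power2_norm_eq_inner[symmetric] power2_eq_square field_simps)
    also have "\<dots> \<le> \<mu> * (v \<bullet> v)"
      unfolding \<mu>_def by (intro mult_right_mono max) (use False in auto)
    finally show ?thesis .
  qed simp
  define B where "B = \<mu> *\<^sub>R mat 1 - A"
  have Bv: "B *v v = \<mu> *\<^sub>R v - A *v v" for v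
    by (simp add: B_def matrix_vector_mult_diff_rdistrib scaleR_matrix_vector_assoc[symmetric])
  have symB: "transpose B = B"
    using sym by (simp add: B_def transpose_def mat_def vec_eq_iff)
  have "(w \<bullet> (B *v u))\<^sup>2 \<le> 0" for w
  proof -
    have "(w \<bullet> (B *v u))\<^sup>2 \<le> (w \<bullet> (B *v w)) * (u \<bullet> (B *v u))"
      using le by (intro psd_Cauchy_Schwarz symB) (simp add: Bv inner_diff_right)
    also have "u \<bullet> (B *v u) = 0"
      using u by (simp add: Bv inner_diff_right \<mu>_def power2_norm_eq_inner[symmetric])
    finally show ?thesis by simp
  qed
  then have "B *v u = 0" by (metis inner_eq_zero_iff power2_less_eq_zero_iff)
  then have "A *v u = \<mu> *\<^sub>R u" by (simp add: Bv)
  moreover have "u \<noteq> 0" using u by auto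
  moreover have "k \<le> \<mu>" if "v \<noteq> 0" "A *v v = k *\<^sub>R v" for k v
    using le[of v] that by simp
  ultimately have "largest_eigenvalue A = \<mu>"
    unfolding largest_eigenvalue_def
    by (intro Max_eqI finite_eigenvalues_symmetric[OF sym]) auto
  with le show ?thesis by simp
qed

section \<open>The Laplacian under removal of one edge\<close>

text \<open>The outer product of this vector with itself is the Laplacian of the single edge
  \<open>{p, q}\<close> of weight 1; swapping \<open>p\<close> and \<open>q\<close> changes only the
  sign of the vector and leaves the product alone.\<close>

definition incidence :: "'n \<Rightarrow> 'n \<Rightarrow> real^'n" where
  "incidence p q = axis p 1 - axis q 1"

lemma incidence_inner: "incidence p q \<bullet> x = x $ p - x $ q"
  by (simp add: incidence_def inner_diff_left inner_axis')

lemma incidence_nth: "incidence p q $ i = (if i = p then 1 else 0) - (if i = q then 1 else 0)"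
  by (simp add: incidence_def axis_def)

lemma incidence_norm: "p \<noteq> q \<Longrightarrow> incidence p q \<bullet> incidence p q = 2"
  by (simp add: incidence_inner incidence_nth)

lemma incidence_outer_nth:
  assumes "p \<noteq> q"
  shows "incidence p q $ i * incidence p q $ j =
    (if i = j then (if i \<in> {p, q} then 1 else 0) else if {i, j} = {p, q} then -1 else 0)"
  using assms by (auto simp: incidence_nth doubleton_eq_iff)

lemma laplacian_insert:
  fixes F :: "'n::finite set set"
  assumes pq: "p \<noteq> q" and notin: "{p, q} \<notin> F"
  shows "laplacian (insert {p, q} F) w $ i $ j =
    laplacian F w $ i $ j + w {p, q} * (incidence p q $ i * incidence p q $ j)"
proof (cases "i = j")
  case True
  have "{e \<in> insert {p, q} F. i \<in> e} =
      (if i \<in> {p, q} then insert {p, q} {e \<in> F. i \<in> e} else {e \<in> F. i \<in> e})" by auto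
  then have "(\<Sum>e\<in>{e \<in> insert {p, q} F. i \<in> e}. w e) =
      (\<Sum>e\<in>{e \<in> F. i \<in> e}. w e) + (if i \<in> {p, q} then w {p, q} else 0)"
    using notin by simp
  \<comment> \<open>The adjacency matrix also looks up \<open>{i, i}\<close>, so its diagonal must
    be seen to be unaffected by the new edge.\<close>
  moreover have "{i, i} \<noteq> {p, q}" using pq by auto
  ultimately show ?thesis
    using True pq
    by (simp add: laplacian_def degree_matrix_def adjacency_matrix_def incidence_outer_nth
        del: insert_iff) (auto)
next
  case False
  then show ?thesis
    using notin pq
    by (auto simp: laplacian_def degree_matrix_def adjacency_matrix_def incidence_outer_nth
        simp del: doubleton_eq_iff)
qed

lemma laplacian_insert_mult:
  fixes F :: "'n::finite set set"
  assumes "p \<noteq> q" "{p, q} \<notin> F"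
  shows "laplacian (insert {p, q} F) w *v x =
    laplacian F w *v x + (w {p, q} * (incidence p q \<bullet> x)) *\<^sub>R incidence p q"
proof -
  have "(laplacian (insert {p, q} F) w *v x) $ i =
    (laplacian F w *v x) $ i + w {p, q} * (incidence p q \<bullet> x) * incidence p q $ i" for i
    by (simp add: matrix_vector_mult_def laplacian_insert[OF assms] inner_vec_def
        sum.distrib sum_distrib_left sum_distrib_right algebra_simps)
  then show ?thesis by (simp add: vec_eq_iff)
qed

lemma transpose_laplacian: "transpose (laplacian F w) = laplacian F w"
  by (simp add: transpose_def laplacian_def degree_matrix_def adjacency_matrix_def vec_eq_iff
      insert_commute)

lemma weighted_graph_edgeE:
  assumes "weighted_graph F w" "e \<in> F"
  obtains p q where "e = {p, q}" "p \<noteq> q" "0 < w e"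
  using assms by (auto simp: weighted_graph_def card_2_iff)

lemma weighted_graph_subset: "weighted_graph F w \<Longrightarrow> G \<subseteq> F \<Longrightarrow> weighted_graph G w"
  by (auto simp: weighted_graph_def)

section \<open>The quadratic form and the kernel of the Laplacian\<close>

lemma laplacian_empty: "laplacian {} w = 0"
  by (simp add: laplacian_def degree_matrix_def adjacency_matrix_def vec_eq_iff)

text \<open>Each inserted edge adds \<open>w e\<close> times the square of
  \<open>incidence p q \<bullet> x\<close> to the quadratic form.\<close>

lemma laplacian_union_le:
  fixes G :: "'n::finite set set"
  assumes "weighted_graph (D \<union> G) w" "D \<inter> G = {}"
  shows "x \<bullet> (laplacian G w *v x) \<le> x \<bullet> (laplacian (D \<union> G) w *v x)"
  using finite[of D] assms
proof (induction D rule: finite_induct)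
  case empty
  then show ?case by simp
next
  case (insert e D)
  obtain p q where e: "e = {p, q}" "p \<noteq> q" "0 < w e"
    using insert.prems(1) by (rule weighted_graph_edgeE) auto
  have "x \<bullet> (laplacian G w *v x) \<le> x \<bullet> (laplacian (D \<union> G) w *v x)"
    using insert.prems by (intro insert.IH) (auto simp: weighted_graph_def)
  also have "\<dots> \<le> x \<bullet> (laplacian (insert e (D \<union> G)) w *v x)"
    using e insert by (simp add: laplacian_insert_mult inner_add_right inner_commute mult.assoc)
  finally show ?case by simp
qed

lemma laplacian_mono:
  assumes "weighted_graph F w" "G \<subseteq> F"
  shows "x \<bullet> (laplacian G w *v x) \<le> x \<bullet> (laplacian F w *v x)"
proof -
  have "(F - G) \<union> G = F" using assms by auto
  then show ?thesis using laplacian_union_le[of "F - G" G w x] assms(1) by auto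
qed

lemma laplacian_psd: "weighted_graph F w \<Longrightarrow> 0 \<le> x \<bullet> (laplacian F w *v x)"
  using laplacian_mono[of F w "{}" x] by (simp add: laplacian_empty)

lemma laplacian_const:
  fixes F :: "'n::finite set set"
  assumes "weighted_graph F w"
  shows "laplacian F w *v 1 = 0"
  using finite[of F] assms
proof (induction F rule: finite_induct)
  case empty
  then show ?case by (simp add: laplacian_empty)
next
  case (insert e F)
  obtain p q where "e = {p, q}" "p \<noteq> q"
    using insert.prems by (rule weighted_graph_edgeE) auto
  moreover have "laplacian F w *v 1 = 0"
    using insert by (auto simp: weighted_graph_def)
  ultimately show ?case
    using insert.hyps by (simp add: laplacian_insert_mult incidence_inner)
qed

section \<open>The forest matrix\<close>

lemma mat_1_plus_mult: "(mat 1 + A) *v x = x + A *v (x :: real^'n)"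
  by (simp add: matrix_vector_mult_add_rdistrib)

text \<open>The Laplacian is positive semidefinite, so \<open>mat 1\<close> plus it has trivial
  kernel; \<open>matrix_inv\<close> is a choice of two-sided inverse and becomes usable once one
  exists.\<close>

lemma forest_matrix_inverse:
  assumes "weighted_graph F w"
  shows "(mat 1 + laplacian F w) *v (forest_matrix F w *v x) = x"
    and "forest_matrix F w *v ((mat 1 + laplacian F w) *v x) = x"
proof -
  let ?M = "mat 1 + laplacian F w"
  have "y = 0" if "?M *v y = 0" for y
  proof -
    have "y \<bullet> y + y \<bullet> (laplacian F w *v y) = y \<bullet> (?M *v y)"
      by (simp add: mat_1_plus_mult inner_add_right)
    then have "y \<bullet> y \<le> 0" using that laplacian_psd[OF assms, of y] by simp
    then show ?thesis by (metis inner_eq_zero_iff inner_ge_zero order_antisym)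
  qed
  then have "invertible ?M"
    using matrix_left_invertible_ker[of ?M] by (simp add: invertible_left_inverse)
  then have "?M ** forest_matrix F w = mat 1 \<and> forest_matrix F w ** ?M = mat 1"
    unfolding forest_matrix_def matrix_inv_def invertible_def by (rule someI_ex)
  then show "?M *v (forest_matrix F w *v x) = x" "forest_matrix F w *v (?M *v x) = x"
    by (simp_all add: matrix_vector_mul_assoc)
qed

lemma forest_matrix_self_adjoint:
  assumes "weighted_graph F w"
  shows "x \<bullet> (forest_matrix F w *v y) = (forest_matrix F w *v x) \<bullet> y"
proof -
  let ?M = "mat 1 + laplacian F w" and ?O = "forest_matrix F w"
  have "x \<bullet> (?O *v y) = (?M *v (?O *v x)) \<bullet> (?O *v y)"
    by (simp add: forest_matrix_inverse[OF assms])
  also have "\<dots> = (?O *v x) \<bullet> (?M *v (?O *v y))"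
    using symmetric_inner_swap[OF transpose_laplacian, of "?O *v x" F w "?O *v y"]
    by (simp add: mat_1_plus_mult inner_add_left inner_add_right)
  finally show ?thesis by (simp add: forest_matrix_inverse[OF assms])
qed

text \<open>The all-ones vector \<open>1\<close> is fixed by I + L, hence by its inverse, so every
  row of the forest matrix sums to 1.\<close>

lemma forest_index_trace:
  fixes F :: "'n::finite set set"
  assumes "weighted_graph F w"
  shows "forest_index F w = CARD('n) * trace (forest_matrix F w) - CARD('n)"
proof -
  let ?O = "forest_matrix F w"
  have "?O *v 1 = 1"
    using forest_matrix_inverse(2)[OF assms, of 1]
    by (simp add: mat_1_plus_mult laplacian_const[OF assms])
  then have row: "(\<Sum>j\<in>UNIV. ?O $ i $ j) = 1" for i
    by (simp add: matrix_vector_mult_def vec_eq_iff)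
  have "(\<Sum>i\<in>UNIV. \<Sum>j\<in>UNIV. ?O $ i $ i + ?O $ j $ j - 2 * ?O $ i $ j) =
      2 * (CARD('n) * trace ?O - CARD('n))"
    by (simp add: sum.distrib sum_subtractf sum_distrib_left[symmetric] row trace_def)
  then show ?thesis by (simp add: forest_index_def Let_def)
qed

text \<open>The resolvent identity, with the difference of the two inverses of rank one.\<close>

lemma forest_matrix_insert_mult:
  fixes F :: "'n::finite set set"
  assumes wg: "weighted_graph (insert {p, q} F) w" and pq: "p \<noteq> q" and notin: "{p, q} \<notin> F"
  defines "b \<equiv> incidence p q"
  shows "forest_matrix F w *v v = forest_matrix (insert {p, q} F) w *v v +
    (w {p, q} * (b \<bullet> (forest_matrix (insert {p, q} F) w *v v))) *\<^sub>R (forest_matrix F w *v b)"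
proof -
  have wgF: "weighted_graph F w" using wg by (rule weighted_graph_subset) auto
  define z where "z = forest_matrix (insert {p, q} F) w *v v"
  have "v = (mat 1 + laplacian (insert {p, q} F) w) *v z"
    by (simp add: z_def forest_matrix_inverse[OF wg])
  also have "\<dots> = (mat 1 + laplacian F w) *v z + (w {p, q} * (b \<bullet> z)) *\<^sub>R b"
    by (simp add: mat_1_plus_mult laplacian_insert_mult[OF pq notin] b_def)
  finally have "forest_matrix F w *v v =
      forest_matrix F w *v ((mat 1 + laplacian F w) *v z + (w {p, q} * (b \<bullet> z)) *\<^sub>R b)"
    by simp
  then show ?thesis
    by (simp add: matrix_vector_right_distrib matrix_vector_mult_scaleR
        forest_matrix_inverse[OF wgF] z_def)
qed

text \<open>Evaluating the resolvent identity at unit vectors and using self-adjointness turns each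
  difference of diagonal entries into a product of coordinates; summing these yields the inner
  product.\<close>

lemma forest_index_insert:
  fixes F :: "'n::finite set set" and w :: "'n set \<Rightarrow> real"
  assumes wg: "weighted_graph (insert {p, q} F) w" and pq: "p \<noteq> q" and notin: "{p, q} \<notin> F"
  defines "b \<equiv> incidence p q"
  shows "forest_index F w - forest_index (insert {p, q} F) w = CARD('n) * w {p, q} *
    ((forest_matrix (insert {p, q} F) w *v b) \<bullet> (forest_matrix F w *v b))"
proof -
  let ?O = "forest_matrix F w" and ?P = "forest_matrix (insert {p, q} F) w"
  have wgF: "weighted_graph F w" using wg by (rule weighted_graph_subset) auto
  have diag: "A $ i $ i = axis i 1 \<bullet> (A *v axis i 1)" for A :: "real^'n^'n" and i
    by (simp add: inner_axis' matrix_vector_mul_component inner_axis)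
  have "?O $ i $ i - ?P $ i $ i = w {p, q} * (?P *v b) $ i * (?O *v b) $ i" for i
    using forest_matrix_insert_mult[OF wg pq notin, of "axis i 1"]
      forest_matrix_self_adjoint[OF wg, of b "axis i 1"]
    unfolding diag b_def by (simp add: inner_add_right inner_axis' inner_axis)
  then have "trace ?O - trace ?P = w {p, q} * ((?P *v b) \<bullet> (?O *v b))"
    by (simp add: trace_def sum_subtractf[symmetric] inner_vec_def sum_distrib_left mult.assoc)
  then show ?thesis
    by (simp add: forest_index_trace[OF wg] forest_index_trace[OF wgF] right_diff_distrib[symmetric])
qed

text \<open>The extra rank-one term sends \<open>y\<close> to a multiple of \<open>b\<close>, so the
  larger matrix also maps \<open>y\<close> to a multiple of \<open>b\<close>.\<close>

lemma forest_matrix_insert_incidence: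
  fixes F :: "'n::finite set set"
  assumes wg: "weighted_graph (insert {p, q} F) w" and pq: "p \<noteq> q" and notin: "{p, q} \<notin> F"
  defines "b \<equiv> incidence p q"
  defines "x \<equiv> forest_matrix (insert {p, q} F) w *v b" and "y \<equiv> forest_matrix F w *v b"
  shows "y = (1 + w {p, q} * (b \<bullet> y)) *\<^sub>R x"
proof -
  have wgF: "weighted_graph F w" using wg by (rule weighted_graph_subset) auto
  have "(mat 1 + laplacian (insert {p, q} F) w) *v y = (1 + w {p, q} * (b \<bullet> y)) *\<^sub>R b"
    using forest_matrix_inverse(1)[OF wgF, of b]
    by (simp add: mat_1_plus_mult laplacian_insert_mult[OF pq notin] b_def[symmetric] y_def[symmetric]
        scaleR_add_left flip: add.assoc)
  then have "forest_matrix (insert {p, q} F) w *v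
      ((mat 1 + laplacian (insert {p, q} F) w) *v y) = (1 + w {p, q} * (b \<bullet> y)) *\<^sub>R x"
    by (simp add: matrix_vector_mult_scaleR x_def)
  then show ?thesis by (simp add: forest_matrix_inverse[OF wg])
qed

section \<open>Norm bounds for the forest matrix\<close>

lemma inner_le_forest_matrix:
  assumes "weighted_graph F w"
  shows "(forest_matrix F w *v b) \<bullet> (forest_matrix F w *v b) \<le> b \<bullet> (forest_matrix F w *v b)"
proof -
  let ?y = "forest_matrix F w *v b"
  have "?y + laplacian F w *v ?y = b"
    using forest_matrix_inverse(1)[OF assms, of b] by (simp add: mat_1_plus_mult)
  then have "?y \<bullet> ?y + ?y \<bullet> (laplacian F w *v ?y) = b \<bullet> ?y"
    by (metis inner_add_right inner_commute)
  then show ?thesis using laplacian_psd[OF assms, of ?y] by linarith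
qed

lemma forest_matrix_norm_le:
  assumes "weighted_graph F w"
  shows "norm (forest_matrix F w *v b) \<le> norm b"
proof -
  let ?y = "forest_matrix F w *v b"
  have "norm ?y * norm ?y \<le> norm b * norm ?y"
    using inner_le_forest_matrix[OF assms, of b] norm_cauchy_schwarz[of b ?y]
    by (simp add: power2_norm_eq_inner[symmetric] power2_eq_square)
  then show ?thesis by (cases "?y = 0") auto
qed

lemma largest_eigenvalue_laplacian_nonneg:
  fixes E :: "'n::finite set set"
  assumes "weighted_graph E w"
  shows "0 \<le> largest_eigenvalue (laplacian E w)"
  using Rayleigh_le_largest_eigenvalue[OF transpose_laplacian, of "1 :: real^'n" E w]
  by (simp add: laplacian_const[OF assms] zero_le_mult_iff inner_vec_def)

text \<open>By monotonicity of the quadratic form, the largest eigenvalue for \<open>E\<close>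
  controls I + L for every subgraph, so one constant serves all \<open>F\<close>.\<close>

lemma forest_matrix_norm_ge:
  fixes E :: "'n::finite set set"
  assumes wg: "weighted_graph E w" and F: "F \<subseteq> E"
  shows "norm b \<le> (1 + largest_eigenvalue (laplacian E w)) * norm (forest_matrix F w *v b)"
proof -
  let ?\<mu> = "1 + largest_eigenvalue (laplacian E w)" and ?M = "mat 1 + laplacian F w"
  note wgF = weighted_graph_subset[OF wg F]
  have "norm (?M *v (forest_matrix F w *v b)) \<le> ?\<mu> * norm (forest_matrix F w *v b)"
  proof (rule psd_norm_le)
    have "transpose ?M = transpose (mat 1) + transpose (laplacian F w)"
      by (simp add: transpose_def vec_eq_iff)
    then show "transpose ?M = ?M" by (simp add: transpose_laplacian)
    show "0 \<le> v \<bullet> (?M *v v)" for v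
      using laplacian_psd[OF wgF, of v] by (simp add: mat_1_plus_mult inner_add_right)
    show "v \<bullet> (?M *v v) \<le> ?\<mu> * (v \<bullet> v)" for v
      using laplacian_mono[OF wg F, of v]
        Rayleigh_le_largest_eigenvalue[OF transpose_laplacian, of v E w]
      by (simp add: mat_1_plus_mult inner_add_right distrib_right)
    show "0 \<le> ?\<mu>"
      using largest_eigenvalue_laplacian_nonneg[OF wg] by simp
  qed
  then show ?thesis by (simp add: forest_matrix_inverse[OF wgF])
qed

section \<open>Marginal gains\<close>

lemma marginal_gain_eq:
  fixes E :: "'n::finite set set"
  assumes "T \<subseteq> E" "e \<in> E - T"
  shows "marginal (edge_removal_gain E w) {e} T =
    forest_index (E - T - {e}) w - forest_index (insert e (E - T - {e})) w"
proof -
  have "E - insert e T = E - T - {e}" "insert e (E - T - {e}) = E - T" using assms by auto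
  then show ?thesis by (simp add: marginal_insert edge_removal_gain_def)
qed

lemma forest_index_insert_bounds:
  fixes E :: "'n::finite set set" and w :: "'n set \<Rightarrow> real"
  assumes wgE: "weighted_graph E w" and sub: "insert e F \<subseteq> E" and notin: "e \<notin> F"
  shows "(1 / (1 + largest_eigenvalue (laplacian E w)))\<^sup>2 * (2 * CARD('n) * w e)
      \<le> forest_index F w - forest_index (insert e F) w"
    and "forest_index F w - forest_index (insert e F) w \<le> 2 * CARD('n) * w e"
proof -
  let ?\<mu> = "1 + largest_eigenvalue (laplacian E w)"
  have wg: "weighted_graph (insert e F) w" using weighted_graph_subset[OF wgE sub] .
  have wgF: "weighted_graph F w" using wg by (rule weighted_graph_subset) auto
  obtain p q where e: "e = {p, q}" and pq: "p \<noteq> q" and we: "0 < w e"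
    using wg by (rule weighted_graph_edgeE) auto
  define b where "b = incidence p q"
  define x where "x = forest_matrix (insert e F) w *v b"
  define y where "y = forest_matrix F w *v b"
  have diff: "forest_index F w - forest_index (insert e F) w = CARD('n) * w e * (x \<bullet> y)"
    unfolding x_def y_def b_def e
    by (rule forest_index_insert) (use wg notin pq e in auto)
  define t where "t = 1 + w e * (b \<bullet> y)"
  have y: "y = t *\<^sub>R x"
    unfolding t_def x_def y_def b_def e
    by (rule forest_matrix_insert_incidence) (use wg notin pq e in auto)
  have "0 \<le> b \<bullet> y"
    using inner_le_forest_matrix[OF wgF, of b] inner_ge_zero[of y] unfolding y_def by linarith
  then have t: "1 \<le> t" using we by (simp add: t_def)
  have b: "b \<bullet> b = 2" using pq by (simp add: b_def incidence_norm)
  have grow: "s \<le> t * s" if "0 \<le> s" for s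
    using mult_right_mono[OF t that] by simp
  have "x \<bullet> y \<le> y \<bullet> y"
    \<comment> \<open>Here \<open>x \<bullet> y\<close> is t times \<open>x \<bullet> x\<close>, and
      \<open>y \<bullet> y\<close> is t squared times it.\<close>
    using grow[of "t * (x \<bullet> x)"] t by (simp add: y)
  also have "\<dots> \<le> 2"
    using forest_matrix_norm_le[OF wgF, of b] b by (simp add: y_def norm_le)
  finally have "x \<bullet> y \<le> 2" .
  from mult_left_mono[OF this, of "CARD('n) * w e"] we
  show "forest_index F w - forest_index (insert e F) w \<le> 2 * CARD('n) * w e"
    unfolding diff by (simp add: mult_ac)
  have \<mu>: "0 < ?\<mu>" using largest_eigenvalue_laplacian_nonneg[OF wgE] by simp
  have "norm b \<le> ?\<mu> * norm x"
    unfolding x_def by (rule forest_matrix_norm_ge[OF wgE sub])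
  then have "(norm b)\<^sup>2 \<le> (?\<mu> * norm x)\<^sup>2" by (intro power_mono) auto
  then have "2 \<le> ?\<mu>\<^sup>2 * (x \<bullet> x)"
    by (simp add: power_mult_distrib power2_norm_eq_inner b)
  then have "(1 / ?\<mu>)\<^sup>2 * 2 \<le> x \<bullet> x"
    using \<mu> by (simp add: field_simps power_divide)
  also have "\<dots> \<le> x \<bullet> y" using grow[of "x \<bullet> x"] by (simp add: y)
  finally have "(1 / ?\<mu>)\<^sup>2 * 2 \<le> x \<bullet> y" .
  from mult_left_mono[OF this, of "CARD('n) * w e"] we
  show "(1 / ?\<mu>)\<^sup>2 * (2 * CARD('n) * w e) \<le> forest_index F w - forest_index (insert e F) w"
    unfolding diff by (simp add: mult_ac)
qed

section \<open>Strict growth of the gain on a path with two edges\<close>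

lemma forest_matrix_empty: "forest_matrix {} w *v x = x"
proof -
  have "weighted_graph {} w" by (simp add: weighted_graph_def)
  from forest_matrix_inverse(1)[OF this, of x] show ?thesis
    by (simp add: mat_1_plus_mult laplacian_empty)
qed

text \<open>With \<open>t = a / (1 + 2 a)\<close>, where \<open>a\<close> is the weight of \<open>{p, r}\<close>, the two gains of \<open>{p, q}\<close> are
  \<open>n w (2 - 2 t + 2 t\<^sup>2) / (1 + w (2 - t))\<close> and the same expression at \<open>t = 0\<close>.\<close>

lemma path_gain_less:
  fixes p q r :: "'n::finite" and w :: "'n set \<Rightarrow> real"
  assumes pq: "p \<noteq> q" and pr: "p \<noteq> r" and qr: "q \<noteq> r"
    and pos: "0 < w {p, q}" "0 < w {p, r}"
  shows "forest_index {{p, r}} w - forest_index {{p, q}, {p, r}} w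
    < forest_index {} w - forest_index {{p, q}} w"
proof -
  define a v where "a = w {p, r}" and "v = w {p, q}"
  have av: "0 < a" "0 < v" using pos by (simp_all add: a_def v_def)
  have neq: "{p, q} \<noteq> {p, r}" using pq pr qr by (auto simp: doubleton_eq_iff)
  have wg2: "weighted_graph {{p, q}, {p, r}} w" and wgr: "weighted_graph {{p, r}} w"
    and wgq: "weighted_graph {{p, q}} w"
    using pq pr pos by (auto simp: weighted_graph_def)
  define b d where "b = incidence p q" and "d = incidence p r"
  have ip: "b \<bullet> b = 2" "d \<bullet> d = 2" "b \<bullet> d = 1" "d \<bullet> b = 1"
    using pq pr qr by (auto simp: b_def d_def incidence_inner incidence_nth)
  have gain: "forest_index F w - forest_index (insert {p, q} F) w =
      CARD('n) * (v * ((forest_matrix F w *v b) \<bullet> (forest_matrix F w *v b))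
        / (1 + v * (b \<bullet> (forest_matrix F w *v b))))"
    if wgF: "weighted_graph (insert {p, q} F) w" and nF: "{p, q} \<notin> F" for F
  proof -
    define x where "x = forest_matrix (insert {p, q} F) w *v b"
    define y where "y = forest_matrix F w *v b"
    define s where "s = 1 + v * (b \<bullet> y)"
    have "weighted_graph F w" using wgF by (rule weighted_graph_subset) auto
    then have "0 \<le> b \<bullet> y"
      using inner_le_forest_matrix[of F w b] inner_ge_zero[of y] unfolding y_def by linarith
    then have s: "0 < s" using av by (simp add: s_def add_pos_nonneg)
    have y: "y = s *\<^sub>R x"
      unfolding s_def v_def x_def y_def b_def by (rule forest_matrix_insert_incidence[OF wgF pq nF])
    have "v * (x \<bullet> y) = v * (y \<bullet> y) / s" using s by (simp add: y)
    moreover have "forest_index F w - forest_index (insert {p, q} F) w = CARD('n) * (v * (x \<bullet> y))"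
      using forest_index_insert[OF wgF pq nF] by (simp add: x_def y_def b_def v_def mult.assoc)
    ultimately show ?thesis by (simp add: s_def y_def)
  qed
  \<comment> \<open>Solves \<open>a * (1 - 2 * t) = t\<close>, which is exactly what makes I + L map
    \<open>b - t *\<^sub>R d\<close> to \<open>b\<close>.\<close>
  define t where "t = a / (1 + 2 * a)"
  have t: "0 < t" "t < 1 / 2" using av by (simp_all add: t_def field_simps)
  have at: "a * (1 - 2 * t) = t" using av by (simp add: t_def field_simps)
  have "laplacian {{p, r}} w *v u = (a * (d \<bullet> u)) *\<^sub>R d" for u
    using laplacian_insert_mult[OF pr, of "{}" w u] by (simp add: laplacian_empty a_def d_def)
  then have "(mat 1 + laplacian {{p, r}} w) *v (b - t *\<^sub>R d) = b + (a * (1 - 2 * t) - t) *\<^sub>R d"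
    by (simp add: mat_1_plus_mult inner_diff_right ip algebra_simps)
  then have y: "forest_matrix {{p, r}} w *v b = b - t *\<^sub>R d"
    using forest_matrix_inverse(2)[OF wgr, of "b - t *\<^sub>R d"] at by simp
  have yy: "(b - t *\<^sub>R d) \<bullet> (b - t *\<^sub>R d) = 2 - 2 * t + 2 * t\<^sup>2" "b \<bullet> (b - t *\<^sub>R d) = 2 - t"
    by (simp_all add: inner_diff_left inner_diff_right ip algebra_simps power2_eq_square)
  have key: "v * (2 - 2 * t + 2 * t\<^sup>2) / (1 + v * (2 - t)) < v * 2 / (1 + v * 2)"
  proof -
    have "v < (1 - t) * (1 + 2 * v)"
    proof -
      have "1 / 2 * (1 + 2 * v) < (1 - t) * (1 + 2 * v)"
        by (rule mult_strict_right_mono) (use t av in auto)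
      then show ?thesis by simp
    qed
    \<comment> \<open>After cross-multiplication, the difference of the two sides of the goal is
      \<open>2 * v * t\<close> times the slack in the previous inequality.\<close>
    then have "2 * v * t * v < 2 * v * t * ((1 - t) * (1 + 2 * v))"
      using av t by simp
    then have "v * (2 - 2 * t + 2 * t\<^sup>2) * (1 + v * 2) < v * 2 * (1 + v * (2 - t))"
      by (simp add: algebra_simps power2_eq_square)
    moreover have "0 < 1 + v * (2 - t)" "0 < 1 + v * 2"
      using av t by (simp_all add: add_pos_pos)
    ultimately show ?thesis by (simp add: divide_less_eq pos_less_divide_eq)
  qed
  have "forest_index {{p, r}} w - forest_index {{p, q}, {p, r}} w =
      CARD('n) * (v * (2 - 2 * t + 2 * t\<^sup>2) / (1 + v * (2 - t)))"
    using gain[OF wg2] neq by (simp add: y yy)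
  moreover have "forest_index {} w - forest_index {{p, q}} w = CARD('n) * (v * 2 / (1 + v * 2))"
    using gain[OF wgq] by (simp add: forest_matrix_empty ip)
  moreover have "CARD('n) * (v * (2 - 2 * t + 2 * t\<^sup>2) / (1 + v * (2 - t)))
      < CARD('n) * (v * 2 / (1 + v * 2))"
    using key by (intro mult_strict_left_mono) auto
  ultimately show ?thesis by (simp only:)
qed

text \<open>Deleting \<open>T\<close> leaves just the path formed by \<open>e\<close> and
  \<open>f\<close>. Removing both is removing \<open>f\<close> and then \<open>e\<close>, and the
  second removal gains strictly more than it would with \<open>f\<close> present.\<close>

lemma gain_not_submodular:
  fixes E :: "'n::finite set set"
  assumes wg: "weighted_graph E w" and e: "e \<in> E" and f: "f \<in> E"
    and "e \<noteq> f" and meet: "e \<inter> f \<noteq> {}"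
  defines "T \<equiv> E - {e, f}"
  shows "(\<Sum>i\<in>{e, f} - T. marginal (edge_removal_gain E w) {i} T)
    < marginal (edge_removal_gain E w) {e, f} T"
proof -
  obtain p where p: "p \<in> e" "p \<in> f" using meet by auto
  have w: "0 < w e" "0 < w f" using wg e f by (auto simp: weighted_graph_def)
  have c: "card e = 2" "card f = 2" using wg e f by (auto simp: weighted_graph_def)
  obtain q where q: "e = {p, q}" "p \<noteq> q" using c(1) p(1) by (auto simp: card_2_iff)
  obtain r where r: "f = {p, r}" "p \<noteq> r" using c(2) p(2) by (auto simp: card_2_iff)
  have "q \<noteq> r" using q r \<open>e \<noteq> f\<close> by auto
  have sets: "{e, f} - T = {e, f}" "E - T = {e, f}" "insert e (insert f T) = E"
    "E - insert e T = {f}" "E - insert f T = {e}"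
    using e f \<open>e \<noteq> f\<close> by (auto simp: T_def)
  have "forest_index {f} w - forest_index {e, f} w < forest_index {} w - forest_index {e} w"
    using path_gain_less[of p q r w] q r \<open>q \<noteq> r\<close> w by simp
  then show ?thesis
    unfolding sets(1) using \<open>e \<noteq> f\<close>
    by (simp add: marginal_def edge_removal_gain_def sets)
qed

text \<open>The conditions on existence and strictness matter. Without edges every
  \<open>g \<ge> 0\<close> is admissible and there is no largest one. On a nonempty matching the
  gains are additive, so the ratio is 1. On a path with two edges, removing one raises the gain of
  the other, so the curvature is 0; hence its positivity is tied to a failure of
  supermodularity.\<close>

theorem lemma2:
  fixes E :: "'n::finite set set" and w :: "'n set \<Rightarrow> real"
  assumes "weighted_graph E w"
  shows "(E \<noteq> {} \<longrightarrow>
           (\<exists>\<gamma>. is_submodularity_ratio E (edge_removal_gain E w) \<gamma> \<and>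
              (1 / (1 + largest_eigenvalue (laplacian E w)))\<^sup>2 \<le> \<gamma> \<and> \<gamma> \<le> 1 \<and>
              ((\<exists>e\<in>E. \<exists>f\<in>E. e \<noteq> f \<and> e \<inter> f \<noteq> {}) \<longrightarrow> \<gamma> < 1))) \<and>
         (\<exists>\<alpha>. is_curvature E (edge_removal_gain E w) \<alpha> \<and>
              0 \<le> \<alpha> \<and> \<alpha> \<le> 1 - (1 / (1 + largest_eigenvalue (laplacian E w)))\<^sup>2 \<and>
              (\<not> supermodular E (edge_removal_gain E w) \<longrightarrow> 0 < \<alpha>))"
proof -
  let ?f = "edge_removal_gain E w" and ?\<kappa> = "(1 / (1 + largest_eigenvalue (laplacian E w)))\<^sup>2"
  let ?c = "\<lambda>e. 2 * CARD('n) * w e"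
  have nonneg: "0 \<le> largest_eigenvalue (laplacian E w)"
    by (rule largest_eigenvalue_laplacian_nonneg[OF assms])
  then have \<kappa>: "0 < ?\<kappa>" "?\<kappa> \<le> 1" by (auto intro: power_le_one)
  have c: "0 < ?c e" if "e \<in> E" for e
    using assms that by (simp add: weighted_graph_def)
  have lower: "?\<kappa> * ?c e \<le> marginal ?f {e} T" and upper: "marginal ?f {e} T \<le> ?c e"
    if "T \<subseteq> E" "e \<in> E - T" for T e
    unfolding marginal_gain_eq[OF that]
    by (rule forest_index_insert_bounds[OF assms]; use that in auto)+
  have "\<exists>\<gamma>. is_submodularity_ratio E ?f \<gamma> \<and> ?\<kappa> \<le> \<gamma> \<and> \<gamma> \<le> 1 \<and>
      ((\<exists>e\<in>E. \<exists>f\<in>E. e \<noteq> f \<and> e \<inter> f \<noteq> {}) \<longrightarrow> \<gamma> < 1)" if ne: "E \<noteq> {}"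
  proof -
    obtain \<gamma> where \<gamma>: "is_submodularity_ratio E ?f \<gamma>" "?\<kappa> \<le> \<gamma>" "\<gamma> \<le> 1"
      and strict: "\<And>S T. S \<subseteq> E \<Longrightarrow> T \<subseteq> E \<Longrightarrow>
        (\<Sum>i\<in>S - T. marginal ?f {i} T) < marginal ?f S T \<Longrightarrow> \<gamma> < 1"
      using submodularity_ratio_exists[OF finite \<kappa>(1) c lower upper ne] by blast
    have "\<gamma> < 1" if "e \<in> E" "f \<in> E" "e \<noteq> f" "e \<inter> f \<noteq> {}" for e f
      using gain_not_submodular[OF assms that] that by (intro strict) auto
    with \<gamma> show ?thesis by blast
  qed
  moreover have "\<exists>\<alpha>. is_curvature E ?f \<alpha> \<and> 0 \<le> \<alpha> \<and> \<alpha> \<le> 1 - ?\<kappa> \<and> (\<not> supermodular E ?f \<longrightarrow> 0 < \<alpha>)"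
    by (rule curvature_exists[OF finite \<kappa>(1) c lower upper \<kappa>(2)])
  ultimately show ?thesis by blast
qed

end
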